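(* For every $m\ge 2$, the module $A_m = C_m/\{\text{four-term relations and cyclic permutation}\}$ is spanned by (the classes of) words in the generators $A(i,m)$, $i=1,\dots,m-1$, of $C_m$.
   Context: Fix a commutative coefficient ring with $1$. The chord algebra $C_m$ is the associative unital algebra over this ring with generators $A(i,j)=A(j,i)$, $1\le i< j\le m$, and relations $A(i,j)A(k,l)=A(k,l)A(i,j)$ for $i,j,k,l$ distinct. The (braid form of the) four-term relations are $$[A(i,j),\,A(j,k)+A(i,k)]=0\qquad (i,j,k \text{ distinct}),$$ where $[X,Y]=XY-YX$; one divides by the two-sided ideal they generate. Cyclic permutation is the identification of words $W'A(i,j)\sim A(i+1,j+1)W'$ for $i<j<m$ and $W'A(i,m)\sim A(1,i+1)W'$ for $i<m$, where $W'$ is any word in the generators of $C_m$. $A_m$ is the quotient of $C_m$, as a module, by the submodule generated by the two-sided ideal of the four-term relations and all differences $W'A(i,j)-A(i+1,j+1)W'$ ($i<j<m$) and $W'A(i,m)-A(1,i+1)W'$ ($i<m$). *)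

theory Defs
  imports "HOL-Algebra.QuotRing" "HOL-Algebra.Module"
begin

text \<open>Elements of the free algebra are coefficient functions on words. The coefficient of a
  word \<open>w\<close> in a product sums over the \<open>length w + 1\<close> ways of splitting \<open>w\<close> into a prefix and a
  suffix.\<close>

definition free_algebra :: "('r, 'c) ring_scheme \<Rightarrow> 'x set \<Rightarrow> ('r, 'x list \<Rightarrow> 'r) module" where
  "free_algebra R X =
    \<lparr>carrier = {f. f \<in> UNIV \<rightarrow> carrier R \<and> finite {w. f w \<noteq> \<zero>\<^bsub>R\<^esub>} \<and> {w. f w \<noteq> \<zero>\<^bsub>R\<^esub>} \<subseteq> lists X},
     monoid.mult = (\<lambda>f g w. \<Oplus>\<^bsub>R\<^esub>k\<in>{..length w}. f (take k w) \<otimes>\<^bsub>R\<^esub> g (drop k w)),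
     monoid.one = (\<lambda>w. if w = [] then \<one>\<^bsub>R\<^esub> else \<zero>\<^bsub>R\<^esub>),
     ring.zero = (\<lambda>w. \<zero>\<^bsub>R\<^esub>),
     ring.add = (\<lambda>f g w. f w \<oplus>\<^bsub>R\<^esub> g w),
     module.smult = (\<lambda>r f w. r \<otimes>\<^bsub>R\<^esub> f w)\<rparr>"

definition free_gen :: "('r, 'c) ring_scheme \<Rightarrow> 'x \<Rightarrow> 'x list \<Rightarrow> 'r" where
  "free_gen R x = (\<lambda>w. if w = [x] then \<one>\<^bsub>R\<^esub> else \<zero>\<^bsub>R\<^esub>)"

text \<open>The quotient of \<open>M\<close> by \<open>N\<close>: the library's \<^const>\<open>FactRing\<close> together with the induced scalar
  multiplication. It is used for two-sided ideals \<open>N\<close> of an algebra \<open>M\<close>, and for mere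
  submodules \<open>N\<close>; in the second case only the additive structure and the scalar
  multiplication are meaningful, the fields \<open>mult\<close> and \<open>one\<close> are not.\<close>

definition quot_module :: "('r, 'x, 'd) module_scheme \<Rightarrow> 'x set \<Rightarrow> ('r, 'x set) module" where
  "quot_module M N =
    ring.extend (M Quot N) (module.fields (\<lambda>r K. \<Union>x\<in>K. N +>\<^bsub>M\<^esub> (r \<odot>\<^bsub>M\<^esub> x)))"

definition gen_submodule ::
    "('r, 'c) ring_scheme \<Rightarrow> ('r, 'x, 'd) module_scheme \<Rightarrow> 'x set \<Rightarrow> 'x set" where
  "gen_submodule R M S = \<Inter>{H. submodule H R M \<and> S \<subseteq> H}"

definition commutator :: "('x, 'd) ring_scheme \<Rightarrow> 'x \<Rightarrow> 'x \<Rightarrow> 'x" where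
  "commutator C x y = (x \<otimes>\<^bsub>C\<^esub> y) \<ominus>\<^bsub>C\<^esub> (y \<otimes>\<^bsub>C\<^esub> x)"

text \<open>The index of the generator \<open>A(i,j)\<close> is the unordered pair \<open>{i, j}\<close>, so that
  \<open>A(i,j) = A(j,i)\<close> holds by construction.\<close>

definition chords :: "nat \<Rightarrow> nat set set" where
  "chords m = {{i, j} | i j. 1 \<le> i \<and> i < j \<and> j \<le> m}"

definition far_relations :: "('r, 'c) ring_scheme \<Rightarrow> nat \<Rightarrow> (nat set list \<Rightarrow> 'r) set" where
  "far_relations R m =
    {commutator (free_algebra R (chords m)) (free_gen R {i, j}) (free_gen R {k, l}) | i j k l.
      {i, j, k, l} \<subseteq> {1..m} \<and> distinct [i, j, k, l]}"

definition far_ideal :: "('r, 'c) ring_scheme \<Rightarrow> nat \<Rightarrow> (nat set list \<Rightarrow> 'r) set" where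
  "far_ideal R m = Idl\<^bsub>free_algebra R (chords m)\<^esub> (far_relations R m)"

definition chord_algebra ::
    "('r, 'c) ring_scheme \<Rightarrow> nat \<Rightarrow> ('r, (nat set list \<Rightarrow> 'r) set) module" where
  "chord_algebra R m = quot_module (free_algebra R (chords m)) (far_ideal R m)"

definition chord_gen ::
    "('r, 'c) ring_scheme \<Rightarrow> nat \<Rightarrow> nat set \<Rightarrow> (nat set list \<Rightarrow> 'r) set" where
  "chord_gen R m c = far_ideal R m +>\<^bsub>free_algebra R (chords m)\<^esub> free_gen R c"

definition chord_word ::
    "('r, 'c) ring_scheme \<Rightarrow> nat \<Rightarrow> nat set list \<Rightarrow> (nat set list \<Rightarrow> 'r) set" where
  "chord_word R m w =
    foldr (\<lambda>c x. chord_gen R m c \<otimes>\<^bsub>chord_algebra R m\<^esub> x) w \<one>\<^bsub>chord_algebra R m\<^esub>"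

definition four_term_relations ::
    "('r, 'c) ring_scheme \<Rightarrow> nat \<Rightarrow> (nat set list \<Rightarrow> 'r) set set" where
  "four_term_relations R m =
    {commutator (chord_algebra R m)
       (chord_gen R m {i, j})
       (chord_gen R m {j, k} \<oplus>\<^bsub>chord_algebra R m\<^esub> chord_gen R m {i, k}) | i j k.
      {i, j, k} \<subseteq> {1..m} \<and> distinct [i, j, k]}"

definition cyclic_relations ::
    "('r, 'c) ring_scheme \<Rightarrow> nat \<Rightarrow> (nat set list \<Rightarrow> 'r) set set" where
  "cyclic_relations R m =
    {(chord_word R m w \<otimes>\<^bsub>chord_algebra R m\<^esub> chord_gen R m {i, j}) \<ominus>\<^bsub>chord_algebra R m\<^esub>
     (chord_gen R m {i + 1, j + 1} \<otimes>\<^bsub>chord_algebra R m\<^esub> chord_word R m w) | w i j.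
      w \<in> lists (chords m) \<and> 1 \<le> i \<and> i < j \<and> j < m} \<union>
    {(chord_word R m w \<otimes>\<^bsub>chord_algebra R m\<^esub> chord_gen R m {i, m}) \<ominus>\<^bsub>chord_algebra R m\<^esub>
     (chord_gen R m {1, i + 1} \<otimes>\<^bsub>chord_algebra R m\<^esub> chord_word R m w) | w i.
      w \<in> lists (chords m) \<and> 1 \<le> i \<and> i < m}"

definition A_submodule ::
    "('r, 'c) ring_scheme \<Rightarrow> nat \<Rightarrow> (nat set list \<Rightarrow> 'r) set set" where
  "A_submodule R m =
    gen_submodule R (chord_algebra R m)
      (Idl\<^bsub>chord_algebra R m\<^esub> (four_term_relations R m) \<union> cyclic_relations R m)"

definition A_module ::
    "('r, 'c) ring_scheme \<Rightarrow> nat \<Rightarrow> ('r, (nat set list \<Rightarrow> 'r) set set) module" where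
  "A_module R m = quot_module (chord_algebra R m) (A_submodule R m)"

definition A_class ::
    "('r, 'c) ring_scheme \<Rightarrow> nat \<Rightarrow> (nat set list \<Rightarrow> 'r) set \<Rightarrow> (nat set list \<Rightarrow> 'r) set set" where
  "A_class R m x = A_submodule R m +>\<^bsub>chord_algebra R m\<^esub> x"

end

theory Submission
  imports Defs
begin

text \<open>Call a chord \<open>{i, m}\<close> high and every other chord low. Commuting a low chord past a high one
  costs, by the four-term relation, only words with one low chord fewer, because
  \<open>[A(i,j), A(j,m)] = [A(j,m), A(i,m)]\<close>. So modulo words with fewer low chords every word is
  \<open>f u\<close> with \<open>f\<close> high and \<open>u\<close> low. The cyclic relation brings the last letter \<open>A(i,j)\<close> of \<open>u\<close>
  to the front as \<open>A(i+1,j+1)\<close>. This is either high, or it can be moved back behind \<open>f\<close>, with the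
  larger index raised. Induction on the number of low chords, then on the sum of
  \<open>m - j\<close> over the low chords \<open>A(i,j)\<close>, \<open>i < j\<close>, finishes the proof.\<close>

section \<open>Quotients of modules and algebras\<close>

lemma quot_module_simps:
  "carrier (quot_module M N) = a_rcosets\<^bsub>M\<^esub> N"
  "mult (quot_module M N) = rcoset_mult M N"
  "one (quot_module M N) = N +>\<^bsub>M\<^esub> \<one>\<^bsub>M\<^esub>"
  "zero (quot_module M N) = N"
  "add (quot_module M N) = set_add M"
  "smult (quot_module M N) = (\<lambda>r K. \<Union>x\<in>K. N +>\<^bsub>M\<^esub> (r \<odot>\<^bsub>M\<^esub> x))"
  by (simp_all add: quot_module_def FactRing_def ring.defs module.defs)

lemma carrier_quot_module: "carrier (quot_module M N) = (\<lambda>x. N +>\<^bsub>M\<^esub> x) ` carrier M"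
  by (auto simp: quot_module_simps A_RCOSETS_def' a_r_coset_def')

lemma (in module) abelian_subgroup_submodule:
  assumes "submodule N R M"
  shows "abelian_subgroup N M"
  using assms by (intro abelian_subgroupI3 additive_subgroupI M.abelian_group_axioms)
    (simp add: submodule_def)

text \<open>The scalar multiple of a coset is a union over all its representatives. It is well
  defined because \<open>N\<close> is closed under scalars, so that all cosets in the union
  coincide.\<close>

lemma (in module) quot_module_smult:
  assumes N: "submodule N R M" and "r \<in> carrier R" "x \<in> carrier M"
  shows "r \<odot>\<^bsub>quot_module M N\<^esub> (N +>\<^bsub>M\<^esub> x) = N +>\<^bsub>M\<^esub> (r \<odot>\<^bsub>M\<^esub> x)"
proof -
  interpret N: abelian_subgroup N M
    by (rule abelian_subgroup_submodule[OF N])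
  have "N +>\<^bsub>M\<^esub> (r \<odot>\<^bsub>M\<^esub> y) = N +>\<^bsub>M\<^esub> (r \<odot>\<^bsub>M\<^esub> x)" if y: "y \<in> N +>\<^bsub>M\<^esub> x" for y
  proof -
    obtain h where h: "h \<in> N" "y = h \<oplus>\<^bsub>M\<^esub> x"
      using y by (auto simp: a_r_coset_def')
    then have "r \<odot>\<^bsub>M\<^esub> y = r \<odot>\<^bsub>M\<^esub> h \<oplus>\<^bsub>M\<^esub> r \<odot>\<^bsub>M\<^esub> x" "r \<odot>\<^bsub>M\<^esub> h \<in> N"
      using assms submoduleE(4)[OF N] by (auto simp: smult_r_distr)
    then have "r \<odot>\<^bsub>M\<^esub> y \<in> N +>\<^bsub>M\<^esub> (r \<odot>\<^bsub>M\<^esub> x)"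
      by (auto simp: a_r_coset_def')
    then show ?thesis
      using assms by (metis N.a_repr_independence' smult_closed)
  qed
  moreover have "x \<in> N +>\<^bsub>M\<^esub> x"
    using assms by (simp add: N.a_rcos_self)
  ultimately have "(\<Union>y\<in>N +>\<^bsub>M\<^esub> x. N +>\<^bsub>M\<^esub> (r \<odot>\<^bsub>M\<^esub> y)) = N +>\<^bsub>M\<^esub> (r \<odot>\<^bsub>M\<^esub> x)"
    by (intro SUP_eq_const) blast+
  then show ?thesis
    by (simp only: quot_module_simps)
qed

lemma quot_module_add:
  assumes "abelian_subgroup N M" and "x \<in> carrier M" "y \<in> carrier M"
  shows "(N +>\<^bsub>M\<^esub> x) \<oplus>\<^bsub>quot_module M N\<^esub> (N +>\<^bsub>M\<^esub> y) = N +>\<^bsub>M\<^esub> (x \<oplus>\<^bsub>M\<^esub> y)"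
  using abelian_subgroup.a_rcos_sum[OF assms(1)] assms(2,3)
  by (simp add: quot_module_simps)

text \<open>Stated for additive subgroups, because the submodule divided out to form
  \<open>A_module\<close> need not be an ideal.\<close>

lemma abelian_group_quot_module:
  assumes N: "abelian_subgroup N M"
  shows "abelian_group (quot_module M N)"
proof -
  interpret N: abelian_subgroup N M by fact
  have zero: "\<zero>\<^bsub>quot_module M N\<^esub> = N +>\<^bsub>M\<^esub> \<zero>\<^bsub>M\<^esub>"
    using N.a_coset_add_zero[OF N.a_subset] by (simp add: quot_module_simps)
  show ?thesis
  proof (rule abelian_groupI)
    fix X assume "X \<in> carrier (quot_module M N)"
    then obtain x where x: "x \<in> carrier M" "X = N +>\<^bsub>M\<^esub> x"
      by (auto simp: carrier_quot_module)
    then have "(N +>\<^bsub>M\<^esub> (\<ominus>\<^bsub>M\<^esub> x)) \<oplus>\<^bsub>quot_module M N\<^esub> X = \<zero>\<^bsub>quot_module M N\<^esub>"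
      by (simp add: quot_module_add[OF N] zero N.l_neg)
    then show "\<exists>Y \<in> carrier (quot_module M N). Y \<oplus>\<^bsub>quot_module M N\<^esub> X = \<zero>\<^bsub>quot_module M N\<^esub>"
      using x by (auto simp: carrier_quot_module)
  qed (auto simp: carrier_quot_module quot_module_add[OF N] zero N.a_ac)
qed

lemma (in module) module_quot_module:
  assumes N: "submodule N R M"
  shows "module R (quot_module M N)"
  using quot_module_smult[OF N] quot_module_add[OF abelian_subgroup_submodule[OF N]]
    abelian_group_quot_module[OF abelian_subgroup_submodule[OF N]]
  by (intro moduleI R.cring_axioms)
    (auto simp: carrier_quot_module smult_l_distr smult_r_distr smult_assoc1)

lemma (in module) rcos_abelian_group_hom:
  assumes N: "submodule N R M"
  shows "abelian_group_hom M (quot_module M N) (\<lambda>x. N +>\<^bsub>M\<^esub> x)"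
proof -
  interpret Q: module R "quot_module M N"
    by (rule module_quot_module[OF N])
  show ?thesis
    by (intro abelian_group_homI M.abelian_group_axioms Q.M.abelian_group_axioms
        group_hom.intro M.a_group Q.M.a_group group_hom_axioms.intro homI)
      (auto simp: carrier_quot_module quot_module_add[OF abelian_subgroup_submodule[OF N]])
qed

text \<open>Turns the claim that a submodule of a quotient is everything into a claim about its
  preimage. Applied to the quotient maps from \<open>chord_algebra\<close> to
  \<open>A_module\<close> and from the free algebra to \<open>chord_algebra\<close>.\<close>

lemma (in module) submodule_vimage:
  assumes "module R M'" and "abelian_group_hom M M' h"
    and smult: "\<And>r x. \<lbrakk>r \<in> carrier R; x \<in> carrier M\<rbrakk> \<Longrightarrow> h (r \<odot>\<^bsub>M\<^esub> x) = r \<odot>\<^bsub>M'\<^esub> h x"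
    and H: "submodule H R M'"
  shows "submodule {x \<in> carrier M. h x \<in> H} R M"
proof -
  interpret M': module R M' by fact
  interpret h: abelian_group_hom M M' h by fact
  have "\<zero>\<^bsub>M'\<^esub> \<in> H"
    using subgroup.one_closed[OF submodule.axioms(1)[OF H]] by simp
  then show ?thesis
    using M'.submoduleE(3-5)[OF H] by (intro submoduleI) (auto simp: smult)
qed

text \<open>The hypothesis on \<open>S\<close> makes \<open>carrier M\<close> one of the submodules
  that are intersected, which keeps the intersection inside the carrier.\<close>

lemma (in module) gen_submodule_submodule:
  assumes "S \<subseteq> carrier M"
  shows "submodule (gen_submodule R M S) R M"
proof (rule submoduleI)
  show "gen_submodule R M S \<subseteq> carrier M"
    using assms carrier_is_submodule by (auto simp: gen_submodule_def)
  have "\<zero>\<^bsub>M\<^esub> \<in> H" if "submodule H R M" for H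
    using subgroup.one_closed[OF submodule.axioms(1)[OF that]] by simp
  then show "\<zero>\<^bsub>M\<^esub> \<in> gen_submodule R M S"
    by (simp add: gen_submodule_def)
qed (simp_all add: gen_submodule_def submoduleE)

lemma gen_submodule_subset: "S \<subseteq> gen_submodule R M S"
  by (auto simp: gen_submodule_def)

section \<open>The quotient ring by a two-sided ideal\<close>

lemma ring_quot_module:
  assumes "ideal N M"
  shows "ring (quot_module M N)"
proof -
  interpret ideal N M by fact
  have add: "(N +>\<^bsub>M\<^esub> x) \<oplus>\<^bsub>quot_module M N\<^esub> (N +>\<^bsub>M\<^esub> y) = N +>\<^bsub>M\<^esub> (x \<oplus>\<^bsub>M\<^esub> y)"
    and mult: "(N +>\<^bsub>M\<^esub> x) \<otimes>\<^bsub>quot_module M N\<^esub> (N +>\<^bsub>M\<^esub> y) = N +>\<^bsub>M\<^esub> (x \<otimes>\<^bsub>M\<^esub> y)"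
    if "x \<in> carrier M" "y \<in> carrier M" for x y
    using that by (simp_all add: quot_module_simps a_rcos_sum rcoset_mult_add)
  have one: "\<one>\<^bsub>quot_module M N\<^esub> = N +>\<^bsub>M\<^esub> \<one>\<^bsub>M\<^esub>"
    by (simp add: quot_module_simps)
  show ?thesis
    by (intro ringI monoidI abelian_group_quot_module abelian_subgroup_axioms)
      (auto simp: carrier_quot_module add mult one m_assoc l_distr r_distr)
qed

lemma ring_hom_ring_quot_module:
  assumes "ideal N M"
  shows "ring_hom_ring M (quot_module M N) (\<lambda>x. N +>\<^bsub>M\<^esub> x)"
proof -
  interpret ideal N M by fact
  show ?thesis
    using rcos_ring_hom ring_quot_module[OF assms]
    by (intro ring_hom_ringI2 local.ring_axioms)
       (auto simp: ring_hom_def quot_module_simps FactRing_def)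
qed

section \<open>The free algebra\<close>

lemma free_algebra_simps:
  "carrier (free_algebra R X) =
    {f. f \<in> UNIV \<rightarrow> carrier R \<and> finite {w. f w \<noteq> \<zero>\<^bsub>R\<^esub>} \<and> {w. f w \<noteq> \<zero>\<^bsub>R\<^esub>} \<subseteq> lists X}"
  "(f \<otimes>\<^bsub>free_algebra R X\<^esub> g) =
    (\<lambda>w. \<Oplus>\<^bsub>R\<^esub>k\<in>{..length w}. f (take k w) \<otimes>\<^bsub>R\<^esub> g (drop k w))"
  "\<one>\<^bsub>free_algebra R X\<^esub> = (\<lambda>w. if w = [] then \<one>\<^bsub>R\<^esub> else \<zero>\<^bsub>R\<^esub>)"
  "\<zero>\<^bsub>free_algebra R X\<^esub> = (\<lambda>w. \<zero>\<^bsub>R\<^esub>)"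
  "(f \<oplus>\<^bsub>free_algebra R X\<^esub> g) = (\<lambda>w. f w \<oplus>\<^bsub>R\<^esub> g w)"
  "(r \<odot>\<^bsub>free_algebra R X\<^esub> f) = (\<lambda>w. r \<otimes>\<^bsub>R\<^esub> f w)"
  by (simp_all add: free_algebra_def)

text \<open>The monomial of the word \<open>u\<close>. Monomials are the basis of the free algebra,
  and \<open>free_gen\<close> is the case of a single letter.\<close>

definition free_word :: "('r, 'c) ring_scheme \<Rightarrow> 'x list \<Rightarrow> 'x list \<Rightarrow> 'r" where
  "free_word R u = (\<lambda>w. if w = u then \<one>\<^bsub>R\<^esub> else \<zero>\<^bsub>R\<^esub>)"

context cring
begin

context
  fixes X :: "'x set"
begin

private abbreviation "FA \<equiv> free_algebra R X"

section \<open>Laws of multiplication for coefficient functions\<close>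

lemma free_mult_Nil:
  assumes "f \<in> UNIV \<rightarrow> carrier R" "g \<in> UNIV \<rightarrow> carrier R"
  shows "(f \<otimes>\<^bsub>FA\<^esub> g) [] = f [] \<otimes> g []"
  using assms by (simp add: free_algebra_simps Pi_iff)

text \<open>Peeling off the first letter reduces the laws of multiplication to inductions on the word,
  for arbitrary coefficient functions, without reindexing double sums.\<close>

lemma free_mult_Cons:
  assumes "f \<in> UNIV \<rightarrow> carrier R" "g \<in> UNIV \<rightarrow> carrier R"
  shows "(f \<otimes>\<^bsub>FA\<^esub> g) (x # w) = f [] \<otimes> g (x # w) \<oplus> ((\<lambda>v. f (x # v)) \<otimes>\<^bsub>FA\<^esub> g) w"
proof -
  have carr: "f u \<in> carrier R" "g u \<in> carrier R" for u
    using assms by auto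
  have "(f \<otimes>\<^bsub>FA\<^esub> g) (x # w) =
      (\<Oplus>k\<in>{..Suc (length w)}. f (take k (x # w)) \<otimes> g (drop k (x # w)))"
    by (simp add: free_algebra_simps)
  also have "\<dots> = ((\<lambda>v. f (x # v)) \<otimes>\<^bsub>FA\<^esub> g) w \<oplus> f [] \<otimes> g (x # w)"
    using carr by (subst finsum_Suc2) (auto simp: free_algebra_simps)
  finally show ?thesis
    using carr by (simp add: a_comm free_algebra_simps)
qed

lemma free_mult_pointwise_closed:
  assumes "f \<in> UNIV \<rightarrow> carrier R" "g \<in> UNIV \<rightarrow> carrier R"
  shows "(f \<otimes>\<^bsub>FA\<^esub> g) \<in> UNIV \<rightarrow> carrier R"
  using assms by (auto simp: free_algebra_simps Pi_iff)

lemma free_mult_l_distr: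
  assumes "f \<in> UNIV \<rightarrow> carrier R" "g \<in> UNIV \<rightarrow> carrier R" "h \<in> UNIV \<rightarrow> carrier R"
  shows "((\<lambda>w. f w \<oplus> g w) \<otimes>\<^bsub>FA\<^esub> h) w = (f \<otimes>\<^bsub>FA\<^esub> h) w \<oplus> (g \<otimes>\<^bsub>FA\<^esub> h) w"
  using assms by (simp add: free_algebra_simps Pi_iff l_distr finsum_addf)

lemma free_mult_r_distr:
  assumes "f \<in> UNIV \<rightarrow> carrier R" "g \<in> UNIV \<rightarrow> carrier R" "h \<in> UNIV \<rightarrow> carrier R"
  shows "(h \<otimes>\<^bsub>FA\<^esub> (\<lambda>w. f w \<oplus> g w)) w = (h \<otimes>\<^bsub>FA\<^esub> f) w \<oplus> (h \<otimes>\<^bsub>FA\<^esub> g) w"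
  using assms by (simp add: free_algebra_simps Pi_iff r_distr finsum_addf)

lemma free_mult_smult_left:
  assumes "r \<in> carrier R" "f \<in> UNIV \<rightarrow> carrier R" "g \<in> UNIV \<rightarrow> carrier R"
  shows "((\<lambda>w. r \<otimes> f w) \<otimes>\<^bsub>FA\<^esub> g) w = r \<otimes> (f \<otimes>\<^bsub>FA\<^esub> g) w"
  using assms by (simp add: free_algebra_simps Pi_iff m_assoc finsum_rdistr)

lemma free_mult_zero_left:
  assumes "g \<in> UNIV \<rightarrow> carrier R"
  shows "((\<lambda>w. \<zero>) \<otimes>\<^bsub>FA\<^esub> g) w = \<zero>"
  using assms by (simp add: free_algebra_simps Pi_iff)

text \<open>At a nonempty word the shifted unit is the zero function, so only the splitting with
  empty prefix contributes.\<close>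

lemma free_mult_one_left:
  assumes "g \<in> UNIV \<rightarrow> carrier R"
  shows "\<one>\<^bsub>FA\<^esub> \<otimes>\<^bsub>FA\<^esub> g = g"
proof
  have carr: "g u \<in> carrier R" for u
    using assms by auto
  show "(\<one>\<^bsub>FA\<^esub> \<otimes>\<^bsub>FA\<^esub> g) w = g w" for w
    using assms carr free_mult_zero_left[OF assms]
    by (cases w) (simp_all add: free_mult_Nil free_mult_Cons free_algebra_simps(3))
qed

lemma free_mult_one_right:
  assumes "f \<in> UNIV \<rightarrow> carrier R"
  shows "f \<otimes>\<^bsub>FA\<^esub> \<one>\<^bsub>FA\<^esub> = f"
proof
  show "(f \<otimes>\<^bsub>FA\<^esub> \<one>\<^bsub>FA\<^esub>) w = f w" for w
    using assms
  proof (induction w arbitrary: f)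
    case Nil
    then have "f [] \<in> carrier R" by auto
    with Nil show ?case
      by (simp add: free_mult_Nil free_algebra_simps(3))
  next
    case (Cons x w)
    have "f u \<in> carrier R" for u
      using Cons.prems by auto
    then show ?case
      using Cons.prems Cons.IH[of "\<lambda>v. f (x # v)"]
      by (simp add: free_mult_Cons free_algebra_simps(3))
  qed
qed

text \<open>Induction on the word at which both sides are evaluated. Peeling off a letter replaces
  \<open>f\<close> by its shift, so \<open>f\<close> has to stay arbitrary. The term of the empty
  prefix is a scalar multiple of the shift of \<open>g\<close>, and the scalar can be pulled out of
  the product with \<open>h\<close>.\<close>

lemma free_mult_assoc:
  assumes "f \<in> UNIV \<rightarrow> carrier R" "g \<in> UNIV \<rightarrow> carrier R" "h \<in> UNIV \<rightarrow> carrier R"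
  shows "(f \<otimes>\<^bsub>FA\<^esub> g) \<otimes>\<^bsub>FA\<^esub> h = f \<otimes>\<^bsub>FA\<^esub> (g \<otimes>\<^bsub>FA\<^esub> h)"
proof
  show "((f \<otimes>\<^bsub>FA\<^esub> g) \<otimes>\<^bsub>FA\<^esub> h) w = (f \<otimes>\<^bsub>FA\<^esub> (g \<otimes>\<^bsub>FA\<^esub> h)) w" for w
    using assms
  proof (induction w arbitrary: f g)
    case Nil
    have carr: "f u \<in> carrier R" "g u \<in> carrier R" "h u \<in> carrier R" for u
      using Nil by auto
    show ?case
      using Nil carr by (simp add: free_mult_Nil free_mult_pointwise_closed m_assoc)
  next
    case (Cons x w)
    let ?f = "\<lambda>v. f (x # v)" and ?g = "\<lambda>v. g (x # v)"
    have fun_carr: "?f \<in> UNIV \<rightarrow> carrier R" "?g \<in> UNIV \<rightarrow> carrier R"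
        "(\<lambda>v. f [] \<otimes> g (x # v)) \<in> UNIV \<rightarrow> carrier R"
      using Cons.prems by auto
    have prod_carr: "f \<otimes>\<^bsub>FA\<^esub> g \<in> UNIV \<rightarrow> carrier R"
        "g \<otimes>\<^bsub>FA\<^esub> h \<in> UNIV \<rightarrow> carrier R" "?f \<otimes>\<^bsub>FA\<^esub> g \<in> UNIV \<rightarrow> carrier R"
        "?g \<otimes>\<^bsub>FA\<^esub> h \<in> UNIV \<rightarrow> carrier R" "?f \<otimes>\<^bsub>FA\<^esub> (g \<otimes>\<^bsub>FA\<^esub> h) \<in> UNIV \<rightarrow> carrier R"
      by (intro free_mult_pointwise_closed fun_carr Cons.prems)+
    note fun_carr = fun_carr prod_carr
    have carr: "f u \<in> carrier R" "g u \<in> carrier R" "h u \<in> carrier R"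
        "(?g \<otimes>\<^bsub>FA\<^esub> h) u \<in> carrier R" "(?f \<otimes>\<^bsub>FA\<^esub> (g \<otimes>\<^bsub>FA\<^esub> h)) u \<in> carrier R" for u
      using Cons.prems fun_carr by auto
    have "((f \<otimes>\<^bsub>FA\<^esub> g) \<otimes>\<^bsub>FA\<^esub> h) (x # w) = (f [] \<otimes> g []) \<otimes> h (x # w)
        \<oplus> ((\<lambda>v. f [] \<otimes> g (x # v) \<oplus> (?f \<otimes>\<^bsub>FA\<^esub> g) v) \<otimes>\<^bsub>FA\<^esub> h) w"
      using Cons.prems fun_carr by (simp add: free_mult_Cons free_mult_Nil)
    also have "\<dots> = (f [] \<otimes> g []) \<otimes> h (x # w)
        \<oplus> (f [] \<otimes> (?g \<otimes>\<^bsub>FA\<^esub> h) w \<oplus> (?f \<otimes>\<^bsub>FA\<^esub> (g \<otimes>\<^bsub>FA\<^esub> h)) w)"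
      using Cons.prems fun_carr carr Cons.IH[of ?f g]
      by (simp add: free_mult_l_distr free_mult_smult_left)
    also have "\<dots> = f [] \<otimes> (g [] \<otimes> h (x # w) \<oplus> (?g \<otimes>\<^bsub>FA\<^esub> h) w) \<oplus> (?f \<otimes>\<^bsub>FA\<^esub> (g \<otimes>\<^bsub>FA\<^esub> h)) w"
      using carr by (simp add: m_assoc r_distr a_assoc)
    also have "\<dots> = (f \<otimes>\<^bsub>FA\<^esub> (g \<otimes>\<^bsub>FA\<^esub> h)) (x # w)"
      using Cons.prems fun_carr by (simp add: free_mult_Cons)
    finally show ?case .
  qed
qed

text \<open>A nonzero coefficient at \<open>w\<close> needs a splitting of \<open>w\<close> at which
  both factors are nonzero. So the support consists of concatenations of words from two finite
  supports.\<close>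

lemma free_mult_closed:
  assumes "f \<in> carrier FA" "g \<in> carrier FA"
  shows "f \<otimes>\<^bsub>FA\<^esub> g \<in> carrier FA"
proof -
  let ?S = "\<lambda>f. {w. f w \<noteq> \<zero>}"
  have carr: "f u \<in> carrier R" "g u \<in> carrier R" for u
    using assms by (auto simp: free_algebra_simps)
  have supp: "?S (f \<otimes>\<^bsub>FA\<^esub> g) \<subseteq> (\<lambda>(u, v). u @ v) ` (?S f \<times> ?S g)"
  proof
    fix w assume w: "w \<in> ?S (f \<otimes>\<^bsub>FA\<^esub> g)"
    have "\<exists>k. f (take k w) \<noteq> \<zero> \<and> g (drop k w) \<noteq> \<zero>"
    proof (rule ccontr)
      assume "\<not> ?thesis"
      then have "f (take k w) \<otimes> g (drop k w) = \<zero>" for k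
        using carr by (metis l_null r_null)
      with w show False
        by (simp add: free_algebra_simps)
    qed
    then obtain k where "f (take k w) \<noteq> \<zero>" "g (drop k w) \<noteq> \<zero>" by blast
    then show "w \<in> (\<lambda>(u, v). u @ v) ` (?S f \<times> ?S g)"
      by (intro image_eqI[of _ _ "(take k w, drop k w)"]) auto
  qed
  moreover have "finite ((\<lambda>(u, v). u @ v) ` (?S f \<times> ?S g))"
    using assms by (auto simp: free_algebra_simps)
  moreover have "(\<lambda>(u, v). u @ v) ` (?S f \<times> ?S g) \<subseteq> lists X"
    using assms by (fastforce simp: free_algebra_simps)
  moreover have "f \<otimes>\<^bsub>FA\<^esub> g \<in> UNIV \<rightarrow> carrier R"
    using carr by (intro free_mult_pointwise_closed) auto
  ultimately show ?thesis
    unfolding free_algebra_simps(1) by (auto intro: finite_subset)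
qed

section \<open>Ring and module structure of the free algebra\<close>

lemma abelian_group_free_algebra: "abelian_group FA"
proof (rule abelian_groupI)
  fix f g assume fg: "f \<in> carrier FA" "g \<in> carrier FA"
  have "{w. f w \<oplus> g w \<noteq> \<zero>} \<subseteq> {w. f w \<noteq> \<zero>} \<union> {w. g w \<noteq> \<zero>}"
    using fg by auto
  moreover have "{w. f w \<noteq> \<zero>} \<union> {w. g w \<noteq> \<zero>} \<subseteq> lists X" "finite ({w. f w \<noteq> \<zero>} \<union> {w. g w \<noteq> \<zero>})"
    using fg by (auto simp: free_algebra_simps(1))
  ultimately have "{w. f w \<oplus> g w \<noteq> \<zero>} \<subseteq> lists X" "finite {w. f w \<oplus> g w \<noteq> \<zero>}"
    by (blast, blast intro: finite_subset)
  with fg show "f \<oplus>\<^bsub>FA\<^esub> g \<in> carrier FA"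
    by (auto simp: free_algebra_simps(1,5))
next
  fix f assume f: "f \<in> carrier FA"
  then have carr: "f w \<in> carrier R" for w
    by (auto simp: free_algebra_simps)
  then have "\<ominus> f w = \<zero> \<longleftrightarrow> f w = \<zero>" for w
    using a_inv_closed minus_minus minus_zero by metis
  then have "(\<lambda>w. \<ominus> f w) \<in> carrier FA"
    using f by (auto simp: free_algebra_simps)
  moreover have "(\<lambda>w. \<ominus> f w) \<oplus>\<^bsub>FA\<^esub> f = \<zero>\<^bsub>FA\<^esub>"
    using carr by (auto simp: free_algebra_simps l_neg)
  ultimately show "\<exists>g \<in> carrier FA. g \<oplus>\<^bsub>FA\<^esub> f = \<zero>\<^bsub>FA\<^esub>" by blast
qed (auto simp: free_algebra_simps Pi_iff a_ac)

lemma ring_free_algebra: "ring FA"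
proof (intro ringI monoidI abelian_group_free_algebra free_mult_closed)
  show "\<one>\<^bsub>FA\<^esub> \<in> carrier FA"
    by (auto simp: free_algebra_simps)
  have carr: "f \<in> UNIV \<rightarrow> carrier R" if "f \<in> carrier FA" for f
    using that by (simp add: free_algebra_simps(1))
  fix f g h assume "f \<in> carrier FA" "g \<in> carrier FA" "h \<in> carrier FA"
  note fgh = this[THEN carr]
  show "(f \<otimes>\<^bsub>FA\<^esub> g) \<otimes>\<^bsub>FA\<^esub> h = f \<otimes>\<^bsub>FA\<^esub> (g \<otimes>\<^bsub>FA\<^esub> h)"
    by (intro free_mult_assoc fgh)
  show "(f \<oplus>\<^bsub>FA\<^esub> g) \<otimes>\<^bsub>FA\<^esub> h = f \<otimes>\<^bsub>FA\<^esub> h \<oplus>\<^bsub>FA\<^esub> g \<otimes>\<^bsub>FA\<^esub> h"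
    using free_mult_l_distr[OF fgh] by (simp add: free_algebra_simps(5) fun_eq_iff)
  show "h \<otimes>\<^bsub>FA\<^esub> (f \<oplus>\<^bsub>FA\<^esub> g) = h \<otimes>\<^bsub>FA\<^esub> f \<oplus>\<^bsub>FA\<^esub> h \<otimes>\<^bsub>FA\<^esub> g"
    using free_mult_r_distr[OF fgh] by (simp add: free_algebra_simps(5) fun_eq_iff)
qed (auto intro!: free_mult_one_left free_mult_one_right simp: free_algebra_simps(1))

lemma module_free_algebra: "module R FA"
proof (intro moduleI cring_axioms abelian_group_free_algebra)
  fix r f assume rf: "r \<in> carrier R" "f \<in> carrier FA"
  then have "{w. r \<otimes> f w \<noteq> \<zero>} \<subseteq> {w. f w \<noteq> \<zero>}"
    by auto
  with rf show "r \<odot>\<^bsub>FA\<^esub> f \<in> carrier FA"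
    unfolding free_algebra_simps by (auto intro: finite_subset)
qed (auto simp: free_algebra_simps Pi_iff l_distr r_distr m_assoc)

text \<open>Lets a scalar act as multiplication by a multiple of the unit, which makes two-sided
  ideals into submodules.\<close>

lemma free_smult_mult:
  assumes "r \<in> carrier R" "f \<in> carrier FA" "g \<in> carrier FA"
  shows "(r \<odot>\<^bsub>FA\<^esub> f) \<otimes>\<^bsub>FA\<^esub> g = r \<odot>\<^bsub>FA\<^esub> (f \<otimes>\<^bsub>FA\<^esub> g)"
  using assms free_mult_smult_left by (simp add: free_algebra_simps(1,6) fun_eq_iff)

section \<open>Monomials in the free algebra\<close>

lemma free_word_closed: "u \<in> lists X \<Longrightarrow> free_word R u \<in> carrier FA"
  by (auto simp: free_algebra_simps free_word_def)

text \<open>Induction on \<open>u\<close>: the shift of a monomial by the first letter of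
  \<open>w\<close> is either a shorter monomial or zero.\<close>

lemma free_word_mult: "free_word R u \<otimes>\<^bsub>FA\<^esub> free_word R v = free_word R (u @ v)"
proof
  have carr: "free_word R u \<in> UNIV \<rightarrow> carrier R" for u :: "'x list"
    by (simp add: free_word_def)
  show "(free_word R u \<otimes>\<^bsub>FA\<^esub> free_word R v) w = free_word R (u @ v) w" for w
  proof (induction u arbitrary: w)
    case Nil
    have "free_word R [] = \<one>\<^bsub>FA\<^esub>"
      by (simp add: free_word_def free_algebra_simps)
    then show ?case
      using carr by (simp add: free_mult_one_left)
  next
    case (Cons y u)
    show ?case
    proof (cases w)
      case Nil
      then show ?thesis
        using carr by (simp add: free_mult_Nil) (simp add: free_word_def)
    next
      case (Cons x w')
      have "(\<lambda>v. free_word R (y # u) (x # v)) = (if x = y then free_word R u else (\<lambda>v. \<zero>))"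
        by (auto simp: free_word_def)
      then show ?thesis
        using Cons Cons.IH[of w'] carr free_mult_zero_left[OF carr]
        by (simp add: free_mult_Cons) (simp add: free_word_def)
    qed
  qed
qed

text \<open>Induction on a finite set \<open>S\<close> that contains the support: subtracting one
  multiple of a monomial clears the coefficient at one word of \<open>S\<close>.\<close>

lemma submodule_eq_free_algebra:
  assumes P: "submodule P R FA" and words: "\<And>w. w \<in> lists X \<Longrightarrow> free_word R w \<in> P"
  shows "P = carrier FA"
proof
  interpret FA: module R FA
    by (rule module_free_algebra)
  note P_simps = FA.submoduleE[OF P]
  show "P \<subseteq> carrier FA" by (rule P_simps)
  have "f \<in> P" if "finite S" "f \<in> carrier FA" "{w. f w \<noteq> \<zero>} \<subseteq> S" for S f
    using that
  proof (induction S arbitrary: f rule: finite_induct)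
    case empty
    then have "f = \<zero>\<^bsub>FA\<^esub>"
      by (auto simp: free_algebra_simps)
    then show ?case
      using subgroup.one_closed[OF submodule.axioms(1)[OF P]] by simp
  next
    case (insert w S)
    have carr: "f v \<in> carrier R" for v
      using insert.prems by (auto simp: free_algebra_simps)
    show ?case
    proof (cases "f w = \<zero>")
      case True
      with insert show ?thesis by blast
    next
      case False
      then have "w \<in> lists X"
        using insert.prems by (auto simp: free_algebra_simps)
      have "{v. (f(w := \<zero>)) v \<noteq> \<zero>} \<subseteq> {v. f v \<noteq> \<zero>}"
        by auto
      then have "f(w := \<zero>) \<in> carrier FA"
        using insert.prems unfolding free_algebra_simps(1) by (auto intro: finite_subset)
      then have "f(w := \<zero>) \<in> P"
        by (rule insert.IH) (use insert.prems in auto)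
      moreover have "f w \<odot>\<^bsub>FA\<^esub> free_word R w \<in> P"
        using words[OF \<open>w \<in> lists X\<close>] carr P_simps(4) by blast
      moreover have "f = f(w := \<zero>) \<oplus>\<^bsub>FA\<^esub> f w \<odot>\<^bsub>FA\<^esub> free_word R w"
        using carr by (auto simp: free_algebra_simps free_word_def)
      ultimately show ?thesis
        using P_simps(5) by metis
    qed
  qed
  then show "carrier FA \<subseteq> P"
    by (auto simp: free_algebra_simps(1))
qed

end

end

section \<open>Reduction of words of chords\<close>

lemma chords_iff: "c \<in> chords m \<longleftrightarrow> (\<exists>i j. c = {i, j} \<and> 1 \<le> i \<and> i < j \<and> j \<le> m)"
  by (auto simp: chords_def)

text \<open>Chords are unordered pairs, so either index may be the larger one. This spares the
  relations below any case distinction on the order.\<close>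

lemma doubleton_in_chords:
  assumes "i \<in> {1..m}" "j \<in> {1..m}" "i \<noteq> j"
  shows "{i, j} \<in> chords m"
  using assms by (cases i j rule: linorder_cases) (force simp: chords_iff insert_commute)+

text \<open>The combinatorial core, separated from the linear algebra. One should read
  \<open>P w\<close> as saying that the class of \<open>w\<close> lies in a given span; each premise
  is then what one relation implies. In \<open>four\<close>, once two of the four words of a
  relation lie in the span, the other two do so together or not at all.\<close>

lemma chord_word_induct [consumes 1, case_names base far four_term cyclic]:
  fixes P :: "nat set list \<Rightarrow> bool"
  assumes "w \<in> lists (chords m)"
    and base: "\<And>w. w \<in> lists {{i, m} | i. 1 \<le> i \<and> i \<le> m - 1} \<Longrightarrow> P w"
    and far: "\<And>u v a b. \<lbrakk>u \<in> lists (chords m); v \<in> lists (chords m); a \<in> chords m; b \<in> chords m;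
        a \<inter> b = {}; P (u @ a # b # v)\<rbrakk> \<Longrightarrow> P (u @ b # a # v)"
    and four: "\<And>u v i j k. \<lbrakk>u \<in> lists (chords m); v \<in> lists (chords m); {i, j, k} \<subseteq> {1..m};
        distinct [i, j, k]; P (u @ {i, j} # {i, k} # v); P (u @ {i, k} # {i, j} # v)\<rbrakk>
        \<Longrightarrow> P (u @ {i, j} # {j, k} # v) \<longleftrightarrow> P (u @ {j, k} # {i, j} # v)"
    and cyclic: "\<And>w i j. \<lbrakk>w \<in> lists (chords m); 1 \<le> i; i < j; j < m; P ({i + 1, j + 1} # w)\<rbrakk>
        \<Longrightarrow> P (w @ [{i, j}])"
  shows "P w"
proof -
  define low where "low w = length (filter (\<lambda>c. m \<notin> c) w)" for w :: "nat set list"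
  have low_simps [simp]: "low [] = 0" "low (c # w) = (if m \<in> c then low w else Suc (low w))"
    "low (u @ v) = low u + low v" for c u v w
    by (auto simp: low_def)
  have "\<forall>w \<in> lists (chords m). low w = n \<longrightarrow> P w" for n
  proof (induction n rule: less_induct)
    case (less n)
    have fewer: "P w" if "w \<in> lists (chords m)" "low w < n" for w
      using less that by blast
    \<comment> \<open>A low chord \<open>a\<close> and a high chord \<open>b\<close> may be
      exchanged: the correcting words of the four-term relation satisfy \<open>P\<close> by
      \<open>fewer\<close>. The summand 1 in the last assumption counts \<open>a\<close>.\<close>
    have swap: "P (u @ a # b # v) \<longleftrightarrow> P (u @ b # a # v)"
      if uv: "u \<in> lists (chords m)" "v \<in> lists (chords m)" and a: "a \<in> chords m" "m \<notin> a"
        and b: "b \<in> chords m" "m \<in> b" and n: "low u + low v + 1 = n" for u v a b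
    proof (cases "a \<inter> b = {}")
      case True
      then show ?thesis
        using far[of u v a b] far[of u v b a] uv a b by blast
    next
      case False
      \<comment> \<open>Since \<open>m\<close> lies in \<open>b\<close> but not in \<open>a\<close>,
        the two chords share exactly the index \<open>k\<close>.\<close>
      obtain k where k: "b = {m, k}" "k \<in> {1..m}" "k \<noteq> m" "m \<in> {1..m}"
        using b by (fastforce simp: chords_iff insert_commute)
      with False a have "k \<in> a" by auto
      then obtain l where l: "a = {k, l}" "l \<in> {1..m}" "k \<noteq> l"
        using a by (fastforce simp: chords_iff insert_commute)
      with a have "l \<noteq> m" by auto
      have ml: "{m, l} \<in> chords m"
        using k l \<open>l \<noteq> m\<close> by (intro doubleton_in_chords) auto
      \<comment> \<open>Here the low chord \<open>a\<close> has been replaced by the high chord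
        \<open>{m, l}\<close>, which leaves \<open>n - 1\<close> low chords.\<close>
      have "P (u @ b # {m, l} # v)" "P (u @ {m, l} # b # v)"
        using uv b ml n k by (auto intro!: fewer)
      \<comment> \<open>The four-term relation at \<open>m\<close>, \<open>k\<close>,
        \<open>l\<close>: the chord \<open>b = {m, k}\<close> commutes with the sum of
        \<open>a = {k, l}\<close> and \<open>{m, l}\<close>.\<close>
      then show ?thesis
        using four[of u v m k l] uv k l \<open>l \<noteq> m\<close> by auto
    qed
    \<comment> \<open>Passing a whole block \<open>f\<close> of high chords: letters already passed
      join the prefix \<open>u\<close> without changing its number of low chords.\<close>
    have swap_list: "P (u @ a # f @ v) \<longleftrightarrow> P (u @ f @ a # v)"
      if "u \<in> lists (chords m)" "v \<in> lists (chords m)" "a \<in> chords m" "m \<notin> a"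
        "f \<in> lists (chords m)" "\<forall>b \<in> set f. m \<in> b" "low u + low v + 1 = n" for u v a f
      using that
    proof (induction f arbitrary: u)
      case (Cons b f)
      have "P (u @ a # b # f @ v) \<longleftrightarrow> P (u @ b # a # f @ v)"
      proof -
        have "low f = 0"
          using Cons.prems by (auto simp: low_def)
        then show ?thesis
          using Cons.prems by (intro swap) auto
      qed
      then show ?case
        using Cons.prems Cons.IH[of "u @ [b]"] by auto
    qed simp
    \<comment> \<open>The prefix \<open>u\<close> is there for the induction: the tail behind the
      letter \<open>c\<close> is sorted first, and then a low \<open>c\<close> moves past the block
      of high letters.\<close>
    have sort: "P (u @ filter (\<lambda>c. m \<in> c) w @ filter (\<lambda>c. m \<notin> c) w) \<longleftrightarrow> P (u @ w)"
      if "u \<in> lists (chords m)" "w \<in> lists (chords m)" "low (u @ w) = n" for u w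
      using that
    proof (induction w arbitrary: u)
      case (Cons c w)
      have IH: "P ((u @ [c]) @ filter (\<lambda>c. m \<in> c) w @ filter (\<lambda>c. m \<notin> c) w) \<longleftrightarrow> P ((u @ [c]) @ w)"
        using Cons.prems by (intro Cons.IH) auto
      show ?case
      proof (cases "m \<in> c")
        case True
        with IH show ?thesis by simp
      next
        case False
        have "P (u @ c # filter (\<lambda>c. m \<in> c) w @ filter (\<lambda>c. m \<notin> c) w) \<longleftrightarrow>
              P (u @ filter (\<lambda>c. m \<in> c) w @ c # filter (\<lambda>c. m \<notin> c) w)"
          using Cons.prems False by (intro swap_list) (auto simp: low_def)
        with IH False show ?thesis by simp
      qed
    qed simp
    \<comment> \<open>Inner induction. For a chord, \<open>Max a\<close> is the larger index, so the
      measure drops when that index is raised.\<close>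
    have sorted: "P (f @ u)"
      if "f \<in> lists (chords m)" "u \<in> lists (chords m)" "\<forall>b \<in> set f. m \<in> b" "\<forall>a \<in> set u. m \<notin> a"
        "length u = n" for f u
      using that
    proof (induction "\<Sum>a\<leftarrow>u. m - Max a" arbitrary: u rule: less_induct)
      case less
      have low_f: "low f = 0"
        using less.prems by (auto simp: low_def)
      have low_u: "low u = n"
        using less.prems by (auto simp: low_def)
      show ?case
      proof (cases u rule: rev_cases)
        case Nil
        have "c \<in> {{i, m} | i. 1 \<le> i \<and> i \<le> m - 1}" if "c \<in> set f" for c
        proof -
          have "c \<in> chords m" "m \<in> c"
            using that less.prems by auto
          then obtain i j where "c = {i, j}" "1 \<le> i" "i < j" "j \<le> m" "m \<in> c"
            by (auto simp: chords_iff)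
          then have "c = {i, m}" "i \<le> m - 1"
            by auto
          with \<open>1 \<le> i\<close> show ?thesis
            by blast
        qed
        then show ?thesis
          using Nil by (intro base) auto
      next
        case (snoc u' a)
        then have a: "a \<in> chords m" "m \<notin> a" and u': "u' \<in> lists (chords m)" "low u' + 1 = n"
          using less.prems low_u by auto
        obtain i j where ij: "a = {i, j}" "1 \<le> i" "i < j" "j < m"
          using a by (force simp: chords_iff order.order_iff_strict)
        let ?b = "{i + 1, j + 1}"
        have b: "?b \<in> chords m"
          using ij by (intro doubleton_in_chords) auto
        \<comment> \<open>By the cyclic relation it suffices to treat the word in which the last
          letter \<open>a\<close> has moved to the front and become \<open>?b\<close>.\<close>
        have "P (?b # f @ u')"
        proof (cases "j + 1 = m")
          case True
          \<comment> \<open>Now \<open>?b\<close> contains \<open>m\<close>, so one low chord has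
            disappeared and the outer induction applies.\<close>
          then show ?thesis
            using b u' low_f less.prems by (intro fewer) auto
        next
          case False
          then have m: "m \<notin> ?b"
            using ij by auto
          \<comment> \<open>The chord \<open>?b\<close> is still low. As \<open>j < m\<close>, the
            term \<open>m - j\<close> is positive, and replacing it by \<open>m - (j + 1)\<close>
            lowers the sum by one.\<close>
          have "Max a = j" "Max ?b = j + 1"
            using ij by auto
          then have "P (f @ ?b # u')"
            using less.prems snoc b m ij by (intro less.hyps) auto
          \<comment> \<open>The inner induction gave the word with \<open>?b\<close> behind
            \<open>f\<close>; \<open>swap_list\<close> with empty prefix carries it to the
            front.\<close>
          then show ?thesis
            using swap_list[of "[]" u' ?b f] less.prems u' b m by auto
        qed
        then show ?thesis
          using cyclic[of "f @ u'" i j] less.prems u' ij snoc by auto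
      qed
    qed
    have "P w" if w: "w \<in> lists (chords m)" "low w = n" for w
    proof -
      have "P (filter (\<lambda>c. m \<in> c) w @ filter (\<lambda>c. m \<notin> c) w)"
        using w by (intro sorted) (auto simp: low_def)
      then show ?thesis
        using sort[of "[]" w] w by simp
    qed
    then show ?case
      by blast
  qed
  then show ?thesis
    using assms(1) by blast
qed

section \<open>Spanning\<close>

lemma free_gen_eq_free_word: "free_gen R x = free_word R [x]"
  by (simp add: free_gen_def free_word_def)

lemma (in ring) commutator_closed:
  "\<lbrakk>x \<in> carrier R; y \<in> carrier R\<rbrakk> \<Longrightarrow> commutator R x y \<in> carrier R"
  by (simp add: commutator_def)

context cring
begin

context
  fixes m :: nat
begin

private abbreviation "F \<equiv> free_algebra R (chords m)"
private abbreviation "I \<equiv> far_ideal R m"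
private abbreviation "C \<equiv> chord_algebra R m"
private abbreviation "J \<equiv> Idl\<^bsub>C\<^esub> (four_term_relations R m)"
private abbreviation "N \<equiv> A_submodule R m"
private abbreviation "W \<equiv> chord_word R m"
private abbreviation "gen \<equiv> chord_gen R m"

section \<open>The chord algebra and its words\<close>

interpretation F: ring F
  by (rule ring_free_algebra)

interpretation FM: module R F
  by (rule module_free_algebra)

lemma far_relations_closed: "far_relations R m \<subseteq> carrier F"
  by (auto simp: far_relations_def free_gen_eq_free_word
      intro!: F.commutator_closed free_word_closed doubleton_in_chords)

interpretation I: ideal I F
  unfolding far_ideal_def by (rule F.genideal_ideal[OF far_relations_closed])

text \<open>Scaling by \<open>r\<close> is left multiplication by \<open>r\<close> times the unit,
  under which the ideal is closed.\<close>

lemma submodule_far_ideal: "submodule I R F"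
proof (rule FM.submoduleI)
  fix r x assume r: "r \<in> carrier R" and x: "x \<in> I"
  then have "r \<odot>\<^bsub>F\<^esub> x = (r \<odot>\<^bsub>F\<^esub> \<one>\<^bsub>F\<^esub>) \<otimes>\<^bsub>F\<^esub> x"
    by (simp add: free_smult_mult I.a_Hcarr)
  then show "r \<odot>\<^bsub>F\<^esub> x \<in> I"
    using r x by (simp add: I.I_l_closed)
qed (use I.a_subset I.a_inv_closed in auto)

interpretation C: ring C
  unfolding chord_algebra_def by (rule ring_quot_module[OF I.ideal_axioms])

interpretation CM: module R C
  unfolding chord_algebra_def by (rule FM.module_quot_module[OF submodule_far_ideal])

interpretation q: ring_hom_ring F C "\<lambda>x. I +>\<^bsub>F\<^esub> x"
  unfolding chord_algebra_def by (rule ring_hom_ring_quot_module[OF I.ideal_axioms])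

text \<open>The quotient map is a ring homomorphism and takes monomials to products of generators.
  Closure and concatenation of words in \<open>C\<close> are inherited from the free algebra in this
  way.\<close>

lemma rcos_free_word: "w \<in> lists (chords m) \<Longrightarrow> I +>\<^bsub>F\<^esub> free_word R w = W w"
proof (induction w)
  case Nil
  have "free_word R [] = \<one>\<^bsub>F\<^esub>"
    by (simp add: free_word_def free_algebra_simps)
  then show ?case
    by (simp add: chord_word_def q.hom_one)
next
  case (Cons c w)
  have "free_word R (c # w) = free_word R [c] \<otimes>\<^bsub>F\<^esub> free_word R w"
    by (simp add: free_word_mult)
  with Cons show ?case
    by (simp add: q.hom_mult free_word_closed chord_word_def chord_gen_def free_gen_eq_free_word)
qed

lemma chord_word_closed: "w \<in> lists (chords m) \<Longrightarrow> W w \<in> carrier C"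
  using rcos_free_word[of w] q.hom_closed free_word_closed by metis

lemma chord_gen_closed: "c \<in> chords m \<Longrightarrow> gen c \<in> carrier C"
  by (simp add: chord_gen_def free_gen_eq_free_word free_word_closed)

lemma chord_word_Cons: "W (c # w) = gen c \<otimes>\<^bsub>C\<^esub> W w"
  by (simp add: chord_word_def)

lemma chord_word_singleton: "c \<in> chords m \<Longrightarrow> W [c] = gen c"
  by (simp add: chord_word_def chord_gen_closed)

lemma chord_word_append:
  "\<lbrakk>u \<in> lists (chords m); v \<in> lists (chords m)\<rbrakk> \<Longrightarrow> W (u @ v) = W u \<otimes>\<^bsub>C\<^esub> W v"
  using q.hom_mult[OF free_word_closed free_word_closed, of u v]
  by (simp add: free_word_mult rcos_free_word)

text \<open>Disjoint chords have four distinct indices, so their commutator is a far relation and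
  the two products lie in the same coset.\<close>

lemma chord_gen_far_commute:
  assumes a: "a \<in> chords m" and b: "b \<in> chords m" and disj: "a \<inter> b = {}"
  shows "gen a \<otimes>\<^bsub>C\<^esub> gen b = gen b \<otimes>\<^bsub>C\<^esub> gen a"
proof -
  let ?a = "free_gen R a" and ?b = "free_gen R b"
  have carr: "?a \<in> carrier F" "?b \<in> carrier F"
    using a b by (simp_all add: free_gen_eq_free_word free_word_closed)
  obtain i j where ij: "a = {i, j}" "1 \<le> i" "i < j" "j \<le> m"
    using a by (auto simp: chords_iff)
  obtain k l where kl: "b = {k, l}" "1 \<le> k" "k < l" "l \<le> m"
    using b by (auto simp: chords_iff)
  have "{i, j, k, l} \<subseteq> {1..m}" "distinct [i, j, k, l]"
    using ij kl disj by auto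
  then have "commutator F ?a ?b \<in> far_relations R m"
    unfolding far_relations_def ij kl by blast
  then have "?a \<otimes>\<^bsub>F\<^esub> ?b \<ominus>\<^bsub>F\<^esub> ?b \<otimes>\<^bsub>F\<^esub> ?a \<in> I"
    using F.genideal_self[OF far_relations_closed] unfolding far_ideal_def commutator_def by blast
  then have "I +>\<^bsub>F\<^esub> (?a \<otimes>\<^bsub>F\<^esub> ?b) = I +>\<^bsub>F\<^esub> (?b \<otimes>\<^bsub>F\<^esub> ?a)"
    using carr by (intro I.a_repr_independence'[symmetric] I.a_rcos_module_minus[THEN iffD2])
      (simp_all add: F.ring_axioms)
  then show ?thesis
    using carr by (simp add: chord_gen_def q.hom_mult)
qed

section \<open>The four-term and cyclic relations as relations between words\<close>

lemma four_term_relations_closed: "four_term_relations R m \<subseteq> carrier C"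
  by (auto simp: four_term_relations_def
      intro!: C.commutator_closed C.add.m_closed chord_gen_closed doubleton_in_chords)

interpretation J: ideal J C
  by (rule C.genideal_ideal[OF four_term_relations_closed])

lemma cyclic_relations_closed: "cyclic_relations R m \<subseteq> carrier C"
  by (auto simp: cyclic_relations_def
      intro!: C.minus_closed C.m_closed chord_gen_closed chord_word_closed doubleton_in_chords)

lemma submodule_A_submodule: "submodule N R C"
  unfolding A_submodule_def using J.a_subset cyclic_relations_closed
  by (intro CM.gen_submodule_submodule) blast

text \<open>As \<open>J\<close> is a two-sided ideal, the relation may be multiplied by
  \<open>W u\<close> on the left and by \<open>W v\<close> on the right; expanding yields the four
  words.\<close>

lemma four_term_in_A_submodule:
  assumes u: "u \<in> lists (chords m)" and v: "v \<in> lists (chords m)"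
    and ijk: "{i, j, k} \<subseteq> {1..m}" "distinct [i, j, k]"
  shows "(W (u @ {i, j} # {j, k} # v) \<oplus>\<^bsub>C\<^esub> W (u @ {i, j} # {i, k} # v)) \<ominus>\<^bsub>C\<^esub>
    (W (u @ {j, k} # {i, j} # v) \<oplus>\<^bsub>C\<^esub> W (u @ {i, k} # {i, j} # v)) \<in> N"
proof -
  let ?a = "gen {i, j}" and ?b = "gen {j, k}" and ?c = "gen {i, k}"
  have chords: "{i, j} \<in> chords m" "{j, k} \<in> chords m" "{i, k} \<in> chords m"
    using ijk by (auto intro!: doubleton_in_chords)
  note carr = chords[THEN chord_gen_closed] u[THEN chord_word_closed] v[THEN chord_word_closed]
  have "commutator C ?a (?b \<oplus>\<^bsub>C\<^esub> ?c) \<in> J"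
    using C.genideal_self[OF four_term_relations_closed] ijk
    unfolding four_term_relations_def by blast
  then have "W u \<otimes>\<^bsub>C\<^esub> commutator C ?a (?b \<oplus>\<^bsub>C\<^esub> ?c) \<otimes>\<^bsub>C\<^esub> W v \<in> J"
    using carr by (intro J.I_r_closed J.I_l_closed)
  also have "W u \<otimes>\<^bsub>C\<^esub> commutator C ?a (?b \<oplus>\<^bsub>C\<^esub> ?c) \<otimes>\<^bsub>C\<^esub> W v =
      (W u \<otimes>\<^bsub>C\<^esub> (?a \<otimes>\<^bsub>C\<^esub> (?b \<otimes>\<^bsub>C\<^esub> W v)) \<oplus>\<^bsub>C\<^esub> W u \<otimes>\<^bsub>C\<^esub> (?a \<otimes>\<^bsub>C\<^esub> (?c \<otimes>\<^bsub>C\<^esub> W v))) \<ominus>\<^bsub>C\<^esub>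
      (W u \<otimes>\<^bsub>C\<^esub> (?b \<otimes>\<^bsub>C\<^esub> (?a \<otimes>\<^bsub>C\<^esub> W v)) \<oplus>\<^bsub>C\<^esub> W u \<otimes>\<^bsub>C\<^esub> (?c \<otimes>\<^bsub>C\<^esub> (?a \<otimes>\<^bsub>C\<^esub> W v)))"
    unfolding commutator_def using carr
    by (simp add: a_minus_def C.l_distr C.r_distr C.m_assoc C.minus_add C.l_minus C.r_minus C.a_ac)
  finally show ?thesis
    using u v chords gen_submodule_subset[of "J \<union> cyclic_relations R m" R C]
    by (auto simp: A_submodule_def chord_word_append chord_word_Cons)
qed

text \<open>The cyclic relation for a last letter without \<open>m\<close>, in the form that
  \<open>chord_word_induct\<close> asks for.\<close>

lemma cyclic_in_A_submodule:
  assumes "w \<in> lists (chords m)" "1 \<le> i" "i < j" "j < m"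
  shows "W (w @ [{i, j}]) \<ominus>\<^bsub>C\<^esub> W ({i + 1, j + 1} # w) \<in> N"
proof -
  have "{i, j} \<in> chords m"
    using assms by (intro doubleton_in_chords) auto
  then have "W (w @ [{i, j}]) \<ominus>\<^bsub>C\<^esub> W ({i + 1, j + 1} # w) =
      W w \<otimes>\<^bsub>C\<^esub> gen {i, j} \<ominus>\<^bsub>C\<^esub> gen {i + 1, j + 1} \<otimes>\<^bsub>C\<^esub> W w"
    using assms chord_word_append[of w "[{i, j}]"]
    by (simp add: chord_word_Cons[of "{_, _}" w] chord_word_singleton)
  also have "\<dots> \<in> cyclic_relations R m"
    using assms unfolding cyclic_relations_def by blast
  finally show ?thesis
    using gen_submodule_subset[of "J \<union> cyclic_relations R m" R C]
    unfolding A_submodule_def by blast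
qed

text \<open>A submodule above \<open>N\<close> respects all relations, so membership of
  \<open>W w\<close> in \<open>P\<close> satisfies the premises of \<open>chord_word_induct\<close>.
  Hence \<open>P\<close> contains every word, and words span \<open>C\<close>.\<close>

lemma chord_algebra_spanned:
  assumes P: "submodule P R C" and NP: "N \<subseteq> P"
    and top: "\<And>w. w \<in> lists {{i, m} | i. 1 \<le> i \<and> i \<le> m - 1} \<Longrightarrow> W w \<in> P"
  shows "P = carrier C"
proof
  note P_closed = CM.submoduleE[OF P]
  show "P \<subseteq> carrier C" by (rule P_closed)
  \<comment> \<open>Membership in \<open>P\<close> passes along congruences modulo \<open>P\<close>.
    The four-term and cyclic relations enter through this fact.\<close>
  have add: "x \<in> P" if "x \<ominus>\<^bsub>C\<^esub> y \<in> P" "y \<in> P" "x \<in> carrier C" for x y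
  proof -
    have "x = (x \<ominus>\<^bsub>C\<^esub> y) \<oplus>\<^bsub>C\<^esub> y"
      using that P_closed(1) by (simp add: a_minus_def C.a_assoc C.l_neg subset_iff)
    then show ?thesis
      using that P_closed(5) by metis
  qed
  have words: "W w \<in> P" if "w \<in> lists (chords m)" for w
    using that
  proof (induction rule: chord_word_induct)
    case (base w)
    then show ?case by (rule top)
  next
    case (far u v a b)
    \<comment> \<open>Far commutation is already an equality in \<open>C\<close>, so both words are
      the same element.\<close>
    moreover have "gen a \<otimes>\<^bsub>C\<^esub> (gen b \<otimes>\<^bsub>C\<^esub> W v) = gen b \<otimes>\<^bsub>C\<^esub> (gen a \<otimes>\<^bsub>C\<^esub> W v)"
      using far chord_gen_far_commute[of a b]
      by (simp add: chord_gen_closed chord_word_closed flip: C.m_assoc)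
    ultimately show ?case
      by (simp add: chord_word_append chord_word_Cons)
  next
    case (four_term u v i j k)
    let ?x = "W (u @ {i, j} # {j, k} # v)" and ?y = "W (u @ {j, k} # {i, j} # v)"
    let ?s = "W (u @ {i, j} # {i, k} # v)" and ?t = "W (u @ {i, k} # {i, j} # v)"
    have "{i, j} \<in> chords m" "{j, k} \<in> chords m" "{i, k} \<in> chords m"
      using four_term by (auto intro!: doubleton_in_chords)
    then have carr: "?x \<in> carrier C" "?y \<in> carrier C" "?s \<in> carrier C" "?t \<in> carrier C"
      using four_term by (auto intro!: chord_word_closed)
    have st: "?s \<ominus>\<^bsub>C\<^esub> ?t \<in> P"
      using four_term P_closed(3,5) by (simp add: a_minus_def)
    have rel: "(?x \<oplus>\<^bsub>C\<^esub> ?s) \<ominus>\<^bsub>C\<^esub> (?y \<oplus>\<^bsub>C\<^esub> ?t) \<in> P"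
      using four_term_in_A_submodule[of u v i j k] four_term NP by auto
    \<comment> \<open>The relation regrouped as the difference of \<open>?x\<close> and
      \<open>?y\<close> plus the difference of \<open>?s\<close> and \<open>?t\<close>. The second
      is negated twice to fit the pattern of \<open>add\<close>.\<close>
    have eq: "(?x \<ominus>\<^bsub>C\<^esub> ?y) \<ominus>\<^bsub>C\<^esub> (\<ominus>\<^bsub>C\<^esub> (?s \<ominus>\<^bsub>C\<^esub> ?t)) = (?x \<oplus>\<^bsub>C\<^esub> ?s) \<ominus>\<^bsub>C\<^esub> (?y \<oplus>\<^bsub>C\<^esub> ?t)"
      using carr by (simp add: a_minus_def C.minus_add C.a_ac)
    have xy: "?x \<ominus>\<^bsub>C\<^esub> ?y \<in> P"
    proof (rule add[OF _ P_closed(3)[OF st]])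
      show "(?x \<ominus>\<^bsub>C\<^esub> ?y) \<ominus>\<^bsub>C\<^esub> (\<ominus>\<^bsub>C\<^esub> (?s \<ominus>\<^bsub>C\<^esub> ?t)) \<in> P"
        by (subst eq) (rule rel)
      show "?x \<ominus>\<^bsub>C\<^esub> ?y \<in> carrier C"
        using carr by simp
    qed
    moreover have "?y \<ominus>\<^bsub>C\<^esub> ?x = \<ominus>\<^bsub>C\<^esub> (?x \<ominus>\<^bsub>C\<^esub> ?y)"
      using carr by (simp add: a_minus_def C.minus_add C.a_ac)
    ultimately have "?y \<ominus>\<^bsub>C\<^esub> ?x \<in> P"
      using P_closed(3) by metis
    with xy show ?case
      using carr add by blast
  next
    case (cyclic w i j)
    then have "{i, j} \<in> chords m"
      by (intro doubleton_in_chords) auto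
    then have "W (w @ [{i, j}]) \<in> carrier C"
      using cyclic by (intro chord_word_closed) auto
    moreover have "W (w @ [{i, j}]) \<ominus>\<^bsub>C\<^esub> W ({i + 1, j + 1} # w) \<in> P"
      using cyclic cyclic_in_A_submodule[of w i j] NP by blast
    ultimately show ?case
      using cyclic add by blast
  qed
  \<comment> \<open>That words span was shown for the free algebra, so \<open>P\<close> is pulled
    back along the quotient map.\<close>
  have "{x \<in> carrier F. I +>\<^bsub>F\<^esub> x \<in> P} = carrier F"
  proof (rule submodule_eq_free_algebra)
    show "submodule {x \<in> carrier F. I +>\<^bsub>F\<^esub> x \<in> P} R F"
      using P FM.module_quot_module[OF submodule_far_ideal]
        FM.rcos_abelian_group_hom[OF submodule_far_ideal]
        FM.quot_module_smult[OF submodule_far_ideal]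
      unfolding chord_algebra_def by (intro FM.submodule_vimage) auto
    show "free_word R w \<in> {x \<in> carrier F. I +>\<^bsub>F\<^esub> x \<in> P}" if "w \<in> lists (chords m)" for w
      using that words by (simp add: free_word_closed rcos_free_word)
  qed
  then show "carrier C \<subseteq> P"
    by (auto simp: chord_algebra_def carrier_quot_module)
qed

text \<open>For any submodule \<open>H\<close> that contains the given classes, the preimage in
  \<open>C\<close> contains \<open>N\<close>, because elements of \<open>N\<close> have class zero.
  By \<open>chord_algebra_spanned\<close> this preimage is all of \<open>C\<close>, and the class
  map is onto.\<close>

lemma A_module_spanned:
  "gen_submodule R (A_module R m)
     {A_class R m (W w) | w. w \<in> lists {{i, m} | i. 1 \<le> i \<and> i \<le> m - 1}} = carrier (A_module R m)"
  (is "gen_submodule R ?A ?S = _")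
proof
  interpret A: module R ?A
    unfolding A_module_def by (rule CM.module_quot_module[OF submodule_A_submodule])
  have carrier_A: "carrier ?A = A_class R m ` carrier C"
    by (simp add: A_module_def carrier_quot_module A_class_def)
  have "{i, m} \<in> chords m" if "1 \<le> i" "i \<le> m - 1" for i
    using that by (intro doubleton_in_chords) auto
  then have words: "W w \<in> carrier C" if "w \<in> lists {{i, m} | i. 1 \<le> i \<and> i \<le> m - 1}" for w
    using that by (intro chord_word_closed) auto
  have S: "?S \<subseteq> carrier ?A"
  proof
    fix X assume "X \<in> ?S"
    then obtain w where "X = A_class R m (W w)" "w \<in> lists {{i, m} | i. 1 \<le> i \<and> i \<le> m - 1}"
      by blast
    then show "X \<in> carrier ?A"
      unfolding carrier_A by (auto simp only: intro!: imageI words)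
  qed
  then show "gen_submodule R ?A ?S \<subseteq> carrier ?A"
    by (rule A.submoduleE(1)[OF A.gen_submodule_submodule])
  show "carrier ?A \<subseteq> gen_submodule R ?A ?S"
    unfolding gen_submodule_def
  proof (intro Inter_greatest)
    fix H assume "H \<in> {H. submodule H R ?A \<and> ?S \<subseteq> H}"
    then have H: "submodule H R ?A" "?S \<subseteq> H" by auto
    let ?P = "{y \<in> carrier C. A_class R m y \<in> H}"
    have "?P = carrier C"
    proof (rule chord_algebra_spanned)
      show "submodule ?P R C"
        using H A.module_axioms CM.rcos_abelian_group_hom[OF submodule_A_submodule]
          CM.quot_module_smult[OF submodule_A_submodule]
        unfolding A_module_def A_class_def by (intro CM.submodule_vimage) auto
      interpret N: abelian_subgroup N C
        by (rule CM.abelian_subgroup_submodule[OF submodule_A_submodule])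
      have "A_class R m y = \<zero>\<^bsub>?A\<^esub>" if "y \<in> N" for y
        using that N.a_rcos_const by (simp add: A_class_def A_module_def quot_module_simps)
      moreover have "\<zero>\<^bsub>?A\<^esub> \<in> H"
        using subgroup.one_closed[OF submodule.axioms(1)[OF H(1)]] by simp
      ultimately show "N \<subseteq> ?P"
        using N.a_subset by auto
      show "W w \<in> ?P" if "w \<in> lists {{i, m} | i. 1 \<le> i \<and> i \<le> m - 1}" for w
        using that words[OF that] H(2) by blast
    qed
    then show "carrier ?A \<subseteq> H"
      by (auto simp: carrier_A)
  qed
qed

end

end

theorem proposition5p1:
  fixes R :: "('r, 'c) ring_scheme" and m :: nat
  assumes "cring R" and "m \<ge> 2"
  shows "gen_submodule R (A_module R m)
           {A_class R m (chord_word R m w) | w. w \<in> lists {{i, m} | i. 1 \<le> i \<and> i \<le> m - 1}}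
         = carrier (A_module R m)"
  using assms(1) by (rule cring.A_module_spanned)

end
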